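(* Let $f:I\subseteq\mathbb{R}\to\mathbb{R}$ be a differentiable mapping on $I^{\circ}$ such that $f'\in L[a,b]$, where $a,b\in I^{\circ}$ with $a<b$. If $|f'|^{q}$ is a $P$-function on $[a,b]$, $q\geq 1$, then $$\left|f\left(\frac{a+b}{2}\right)-\frac{1}{b-a}\int_{a}^{b}f(x)\,dx\right|\leq\frac{b-a}{4}\left(|f'(b)|^{q}+|f'(a)|^{q}\right)^{\frac1q}.$$
   Context: $I$ is an interval of real numbers and $I^{\circ}$ is its interior. $L[a,b]$ denotes the integrable functions on $[a,b]$. A function $g:J\to\mathbb{R}$ on an interval $J$ is a $P$-function if $g$ is non-negative and $g(tx+(1-t)y)\leq g(x)+g(y)$ for all $x,y\in J$ and $t\in[0,1]$. *)

theory Defs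
  imports "HOL-Analysis.Analysis"
begin

definition P_function_on :: "real set \<Rightarrow> (real \<Rightarrow> real) \<Rightarrow> bool" where
  "P_function_on J g \<longleftrightarrow>
     is_interval J \<and>
     (\<forall>x\<in>J. 0 \<le> g x) \<and>
     (\<forall>x\<in>J. \<forall>y\<in>J. \<forall>t\<in>{0..1}. g (t * x + (1 - t) * y) \<le> g x + g y)"

end

theory Submission
  imports Defs
begin

text \<open>
  With \<open>t\<close> ranging over \<open>{0..1}\<close>, the point \<open>t * a + (1 - t) * b\<close> sweeps out all of \<open>{a..b}\<close>, so a
  \<open>P\<close>-function is bounded throughout by the sum of its two end values
  (\<open>P_function_on_le_endpoints\<close>).  Applied to \<open>\<bar>f'\<bar> powr q\<close>, this gives the uniform bound
  \<open>\<bar>f'\<bar> \<le> K\<close> with \<open>K = (\<bar>f' b\<bar> powr q + \<bar>f' a\<bar> powr q) powr (1 / q)\<close>, and the mean value theorem makes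
  \<open>f\<close> \<open>K\<close>-Lipschitz on \<open>{a..b}\<close>.  The midpoint inequality for Lipschitz functions
  (\<open>lipschitz_midpoint_inequality\<close>) then yields the constant \<open>(b - a) / 4\<close>: it is the mean distance
  of a point of \<open>{a..b}\<close> from the midpoint.
\<close>

lemma P_function_on_le_endpoints:
  assumes "P_function_on {a..b} g" and "x \<in> {a..b}"
  shows "g x \<le> g a + g b"
proof -
  have "x \<in> closed_segment a b" and ab: "a \<in> {a..b}" "b \<in> {a..b}"
    using assms(2) by (auto simp: closed_segment_eq_real_ivl)
  then obtain u where u: "0 \<le> u" "u \<le> 1" "x = (1 - u) * a + u * b"
    by (auto simp: in_segment)
  have "g ((1 - u) * a + (1 - (1 - u)) * b) \<le> g a + g b"
    using assms(1) ab u(1,2) unfolding P_function_on_def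
    by (metis atLeastAtMost_iff diff_ge_0_iff_ge diff_le_eq le_add_same_cancel1)
  with u(3) show ?thesis by simp
qed

lemma has_integral_dist_midpoint:
  fixes a b :: real
  assumes "a \<le> b"
  shows "((\<lambda>x. \<bar>x - (a + b) / 2\<bar>) has_integral (b - a)\<^sup>2 / 4) {a..b}"
proof -
  define m where "m = (a + b) / 2"
  have am: "a \<le> m" and mb: "m \<le> b" using assms by (auto simp: m_def)
  have "((\<lambda>x. m - x) has_integral (- (m - m)\<^sup>2 / 2) - (- (m - a)\<^sup>2 / 2)) {a..m}"
    by (intro fundamental_theorem_of_calculus am)
       (auto intro!: derivative_eq_intros simp: field_simps
         simp flip: has_real_derivative_iff_has_vector_derivative)
  then have left: "((\<lambda>x. \<bar>x - m\<bar>) has_integral (m - a)\<^sup>2 / 2) {a..m}"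
    by (auto elim: has_integral_eq[rotated])
  have "((\<lambda>x. x - m) has_integral (b - m)\<^sup>2 / 2 - (m - m)\<^sup>2 / 2) {m..b}"
    by (intro fundamental_theorem_of_calculus mb)
       (auto intro!: derivative_eq_intros simp flip: has_real_derivative_iff_has_vector_derivative)
  then have right: "((\<lambda>x. \<bar>x - m\<bar>) has_integral (b - m)\<^sup>2 / 2) {m..b}"
    by (auto elim: has_integral_eq[rotated])
  have sum: "(m - a)\<^sup>2 / 2 + (b - m)\<^sup>2 / 2 = (b - a)\<^sup>2 / 4"
    by (simp add: m_def power2_eq_square field_simps)
  show ?thesis
    using has_integral_combine[OF am mb left right] unfolding sum unfolding m_def .
qed

text \<open>
  Inside the absolute value stands the mean over \<open>{a..b}\<close> of \<open>f m - f x\<close>, where \<open>m\<close> is the midpoint, and this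
  integrand is dominated by \<open>K * \<bar>x - m\<bar>\<close>.
\<close>

lemma lipschitz_midpoint_inequality:
  fixes f :: "real \<Rightarrow> real"
  assumes "a < b"
    and lip: "\<And>x y. x \<in> {a..b} \<Longrightarrow> y \<in> {a..b} \<Longrightarrow> \<bar>f x - f y\<bar> \<le> K * \<bar>x - y\<bar>"
  shows "\<bar>f ((a + b) / 2) - 1 / (b - a) * integral {a..b} f\<bar> \<le> (b - a) / 4 * K"
proof -
  define m where "m = (a + b) / 2"
  have m: "m \<in> {a..b}" using \<open>a < b\<close> by (auto simp: m_def)
  have "0 \<le> K"
    using lip[of a b] \<open>a < b\<close> by (auto simp: zero_le_mult_iff dest: order_trans[OF abs_ge_zero])
  then have "K-lipschitz_on {a..b} f"
    using lip by (auto simp: lipschitz_on_def dist_real_def)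
  then have int_f: "f integrable_on {a..b}"
    by (intro integrable_continuous_real lipschitz_on_continuous_on)
  have dom: "((\<lambda>x. K * \<bar>x - m\<bar>) has_integral K * ((b - a)\<^sup>2 / 4)) {a..b}"
    unfolding m_def using \<open>a < b\<close> by (intro has_integral_mult_right has_integral_dist_midpoint) simp
  have diff: "((\<lambda>x. f m - f x) has_integral (b - a) * f m - integral {a..b} f) {a..b}"
    using has_integral_diff[OF has_integral_const_real[of "f m" a b] integrable_integral[OF int_f]]
      \<open>a < b\<close> by simp
  have "norm (f m - f x) \<le> K * \<bar>x - m\<bar>" if "x \<in> {a..b}" for x
    using lip[OF m that] by (simp add: abs_minus_commute)
  then have "norm (integral {a..b} (\<lambda>x. f m - f x)) \<le> integral {a..b} (\<lambda>x. K * \<bar>x - m\<bar>)"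
    by (rule integral_norm_bound_integral[OF has_integral_integrable[OF diff]
          has_integral_integrable[OF dom]])
  then have "\<bar>(b - a) * f m - integral {a..b} f\<bar> \<le> K * ((b - a)\<^sup>2 / 4)"
    unfolding integral_unique[OF diff] integral_unique[OF dom] by simp
  then have "\<bar>(b - a) * f m - integral {a..b} f\<bar> / (b - a) \<le> K * ((b - a)\<^sup>2 / 4) / (b - a)"
    using \<open>a < b\<close> by (intro divide_right_mono) auto
  moreover have "f m - 1 / (b - a) * integral {a..b} f = ((b - a) * f m - integral {a..b} f) / (b - a)"
    using \<open>a < b\<close> by (simp add: field_simps)
  ultimately have "\<bar>f m - 1 / (b - a) * integral {a..b} f\<bar> \<le> K * ((b - a)\<^sup>2 / 4) / (b - a)"
    using \<open>a < b\<close> by (simp only: abs_divide abs_of_pos diff_gt_0_iff_gt)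
  also have "\<dots> = (b - a) / 4 * K"
    using \<open>a < b\<close> by (simp add: power2_eq_square divide_simps)
  finally show ?thesis by (simp add: m_def)
qed

theorem corollary3:
  fixes f :: "real \<Rightarrow> real" and I :: "real set" and a b q :: real
  assumes "is_interval I"
    and "f differentiable_on interior I"
    and "a \<in> interior I" and "b \<in> interior I" and "a < b"
    and "deriv f absolutely_integrable_on {a..b}"
    and "q \<ge> 1"
    and "P_function_on {a..b} (\<lambda>x. \<bar>deriv f x\<bar> powr q)"
  shows "\<bar>f ((a + b) / 2) - 1 / (b - a) * integral {a..b} f\<bar>
    \<le> (b - a) / 4 * (\<bar>deriv f b\<bar> powr q + \<bar>deriv f a\<bar> powr q) powr (1 / q)"
proof (rule lipschitz_midpoint_inequality[OF \<open>a < b\<close>])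
  let ?K = "(\<bar>deriv f b\<bar> powr q + \<bar>deriv f a\<bar> powr q) powr (1 / q)"
  have sub: "{a..b} \<subseteq> interior I"
    using assms(1,3,4) by (metis interval_subset_is_interval cbox_interval convex_interior
        is_interval_convex_1)
  have der: "(f has_field_derivative deriv f x) (at x within {a..b})" if "x \<in> {a..b}" for x
    using assms(2) sub that
    by (metis DERIV_deriv_iff_real_differentiable differentiable_on_def at_within_open
        has_field_derivative_at_within open_interior subsetD)
  have bound: "norm (deriv f x) \<le> ?K" if "x \<in> {a..b}" for x
  proof -
    have "\<bar>deriv f x\<bar> powr q \<le> \<bar>deriv f b\<bar> powr q + \<bar>deriv f a\<bar> powr q"
      using P_function_on_le_endpoints[OF assms(8) that] by simp
    then have "(\<bar>deriv f x\<bar> powr q) powr (1 / q) \<le> ?K"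
      using \<open>q \<ge> 1\<close> by (intro powr_mono2) auto
    then show ?thesis using \<open>q \<ge> 1\<close> by (simp add: powr_powr)
  qed
  show "\<bar>f x - f y\<bar> \<le> ?K * \<bar>x - y\<bar>" if "x \<in> {a..b}" "y \<in> {a..b}" for x y
    using field_differentiable_bound[OF _ der bound that] that by simp
qed

end
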